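(* Let $n$ be a prime power and $t=2n-1$. Then there exists a constant $C>0$ (depending on $n$) such that for every integer $d\ge t$ there exists a finite set $X\subset(-1,1)^d$ with $|X|\le C d^{t-1}$ satisfying \[ \frac{1}{|X|}\sum_{x\in X}f(x)=\int_{(-1,1)^d}f(\omega)\,\frac{d\omega_1\cdots d\omega_d}{\pi^d\prod_{i=1}^d\sqrt{1-\omega_i^2}}\quad\text{for all } f\in\mathbb{R}_t[x_1,\ldots,x_d]. \]
   Context: $\mathbb{R}_t[x_1,\ldots,x_d]$ denotes the space of real polynomials in $d$ variables of total degree at most $t$. The measure $\pi^{-d}\prod_{i=1}^d(1-\omega_i^2)^{-1/2}d\omega_1\cdots d\omega_d$ on $(-1,1)^d$ is called the equilibrium measure. *)

theory Defs
  imports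
    "HOL-Analysis.Analysis"
    "HOL-Library.Poly_Mapping"
    "HOL-Number_Theory.Prime_Powers"
begin

text \<open>
  Points of \<open>\<real>\<^sup>d\<close> are functions in \<open>{..<d} \<rightarrow>\<^sub>E UNIV\<close> (value \<open>undefined\<close> outside \<open>{..<d}\<close>),
  so that distinct points are distinct functions and \<open>card\<close> counts points of \<open>\<real>\<^sup>d\<close>.
  Polynomials in variables indexed by \<open>nat\<close> are finitely supported families of
  coefficients, indexed by exponent vectors of type \<open>nat \<Rightarrow>\<^sub>0 nat\<close>.
\<close>

type_synonym real_mpoly = "(nat \<Rightarrow>\<^sub>0 nat) \<Rightarrow>\<^sub>0 real"

definition monom_degree :: "(nat \<Rightarrow>\<^sub>0 nat) \<Rightarrow> nat" where
  "monom_degree m = (\<Sum>i\<in>Poly_Mapping.keys m. Poly_Mapping.lookup m i)"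

definition mpoly_eval :: "real_mpoly \<Rightarrow> (nat \<Rightarrow> real) \<Rightarrow> real" where
  "mpoly_eval f x = (\<Sum>m\<in>Poly_Mapping.keys f. Poly_Mapping.lookup f m * (\<Prod>i\<in>Poly_Mapping.keys m. x i ^ Poly_Mapping.lookup m i))"

definition mpolys_upto :: "nat \<Rightarrow> nat \<Rightarrow> real_mpoly set" where
  "mpolys_upto d t = {f. \<forall>m\<in>Poly_Mapping.keys f. Poly_Mapping.keys m \<subseteq> {..<d} \<and> monom_degree m \<le> t}"

definition open_cube :: "nat \<Rightarrow> (nat \<Rightarrow> real) set" where
  "open_cube d = ({..<d} \<rightarrow>\<^sub>E {-1<..<1})"

abbreviation lborel_R :: "nat \<Rightarrow> (nat \<Rightarrow> real) measure" where
  "lborel_R d \<equiv> (\<Pi>\<^sub>M i\<in>{..<d}. lborel)"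

end

theory Submission imports Defs begin

text \<open>
  Under \<open>x\<^sub>i = cos \<theta>\<^sub>i\<close> the equilibrium measure becomes the uniform measure on the torus, and
  polynomials of degree at most \<open>t\<close> become combinations of characters \<open>k\<close> with \<open>|k|\<^sub>1 \<le> t\<close>.
  Hence it suffices to find integers \<open>h\<^sub>0, \<dots>, h\<^sub>d\<^sub>-\<^sub>1\<close> such that \<open>\<Sum> k\<^sub>i h\<^sub>i\<close> is not divisible
  by \<open>N\<close> whenever \<open>0 < |k|\<^sub>1 \<le> t\<close>: then the \<open>N\<close> multiples of \<open>h/N\<close> in the torus annihilate
  all nontrivial characters in question. Such \<open>h\<close> are chosen greedily. A new entry only has to avoid
  the solutions \<open>x\<close> of \<open>a x + b = 0 (mod N)\<close> with \<open>0 < |a| \<le> t\<close> and \<open>b\<close> one of at most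
  \<open>(2d + 1)\<^sup>t\<^sup>-\<^sup>1\<close> combinations of the previous entries; if \<open>N\<close> is coprime to \<open>t!\<close> each
  congruence has one solution, so that some \<open>N = O(d\<^sup>t\<^sup>-\<^sup>1)\<close> suffices.
\<close>

subsection \<open>Cosines and roots of unity\<close>

lemma prod_cis: "(\<Prod>i\<in>A. cis (f i)) = cis (\<Sum>i\<in>A. f i)"
  by (induction A rule: infinite_finite_induct) (simp_all add: cis_mult)

text \<open>Binomial expansion of \<open>((cis x + cis (- x)) / 2) ^ m\<close>. The frequencies
  \<open>2 * j - m\<close> are at most \<open>m\<close> in absolute value, which is how degree
  bounds become bounds on characters.\<close>

lemma cos_power_cis:
  "complex_of_real (cos x) ^ m =
    (\<Sum>j\<le>m. of_real (real (m choose j) / 2 ^ m) * cis ((2 * real j - real m) * x))"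
proof -
  have "complex_of_real (cos x) = (cis x + cis (- x)) / 2"
    by (simp add: complex_eq_iff)
  then have "complex_of_real (cos x) ^ m = (cis x + cis (- x)) ^ m / 2 ^ m"
    by (metis power_divide)
  also have "\<dots> = (\<Sum>j\<le>m. of_nat (m choose j) * cis x ^ j * cis (- x) ^ (m - j)) / 2 ^ m"
    by (simp add: binomial_ring)
  also have "\<dots> = (\<Sum>j\<le>m. of_real (real (m choose j) / 2 ^ m) * cis ((2 * real j - real m) * x))"
    unfolding sum_divide_distrib
  proof (rule sum.cong[OF refl])
    fix j assume "j \<in> {..m}"
    then have "cis x ^ j * cis (- x) ^ (m - j) = cis ((2 * real j - real m) * x)"
      by (simp add: Complex.DeMoivre cis_mult of_nat_diff algebra_simps)
    then show "of_nat (m choose j) * cis x ^ j * cis (- x) ^ (m - j) / 2 ^ m =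
        of_real (real (m choose j) / 2 ^ m) * cis ((2 * real j - real m) * x)"
      by (simp add: mult.assoc)
  qed
  finally show ?thesis .
qed

lemma cos_power_multiple_angle:
  "cos x ^ m = (\<Sum>j\<le>m. real (m choose j) / 2 ^ m * cos ((2 * real j - real m) * x))"
proof -
  have "cos x ^ m = Re (complex_of_real (cos x) ^ m)"
    by (metis Re_complex_of_real of_real_power)
  also have "\<dots> = (\<Sum>j\<le>m. real (m choose j) / 2 ^ m * cos ((2 * real j - real m) * x))"
    unfolding cos_power_cis by (simp del: of_real_divide)
  finally show ?thesis .
qed

text \<open>Orthogonality of the characters of the cyclic group of order \<open>N\<close>: the sum
  is geometric with a ratio \<open>w\<close> satisfying \<open>w ^ N = 1\<close>, and
  \<open>w = 1\<close> exactly when \<open>N\<close> divides \<open>K\<close>.\<close>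

lemma sum_cis_roots_of_unity:
  fixes N :: nat and K :: int
  assumes "N > 0"
  shows "(\<Sum>s<N. cis (2 * pi * real s * real_of_int K / real N)) = (if int N dvd K then of_nat N else 0)"
proof -
  define w where "w = cis (2 * pi * real_of_int K / real N)"
  have pow: "cis (2 * pi * real s * real_of_int K / real N) = w ^ s" for s
    unfolding w_def Complex.DeMoivre by (simp add: mult_ac)
  have wN: "w ^ N = 1"
  proof -
    have "w ^ N = cis (2 * pi * real_of_int K)"
      using assms unfolding w_def Complex.DeMoivre by simp
    then show ?thesis by simp
  qed
  show ?thesis
  proof (cases "int N dvd K")
    case True
    then obtain L where "K = int N * L" by auto
    then have "2 * pi * real_of_int K / real N = 2 * pi * real_of_int L"
      using assms by simp
    then have "w = cis (2 * pi * real_of_int L)" by (simp only: w_def)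
    then have "w = 1" by (metis Ints_of_int cis_multiple_2pi)
    then show ?thesis using True unfolding pow by simp
  next
    case False
    have "w \<noteq> 1"
    proof
      assume "w = 1"
      then have "cos (2 * pi * real_of_int K / real N) = 1"
        by (simp add: w_def complex_eq_iff)
      then obtain L :: int where "2 * pi * real_of_int K / real N = of_int L * 2 * pi"
        using cos_one_2pi_int by blast
      then have "real_of_int K = real_of_int (L * int N)"
        using assms by (simp add: field_simps)
      then have "K = L * int N" by linarith
      then show False using False by simp
    qed
    then show ?thesis using False wN unfolding pow
      by (simp add: geometric_sum)
  qed
qed

subsection \<open>Moments of the equilibrium measure\<close>

text \<open>The constant Fourier coefficient of the \<open>m\<close>-th power of cosine: the central
  binomial coefficient over \<open>2 ^ m\<close> for even \<open>m\<close>, and 0 for odd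
  \<open>m\<close>. Writing it as a sum over all \<open>j\<close> lets a product of moments be
  expanded term by term alongside a product of cosine powers.\<close>

definition arcsine_moment :: "nat \<Rightarrow> real" where
  "arcsine_moment m = (\<Sum>j\<le>m. if 2 * j = m then real (m choose j) / 2 ^ m else 0)"

definition cos_power_primitive :: "nat \<Rightarrow> real \<Rightarrow> real" where
  "cos_power_primitive m \<theta> = (\<Sum>j\<le>m. real (m choose j) / 2 ^ m *
     (if 2 * j = m then \<theta> else sin ((2 * real j - real m) * \<theta>) / (2 * real j - real m)))"

lemma DERIV_cos_power_primitive:
  "(cos_power_primitive m has_real_derivative cos \<theta> ^ m) (at \<theta>)"
proof -
  have "((\<lambda>\<theta>. real (m choose j) / 2 ^ m *
          (if 2 * j = m then \<theta> else sin ((2 * real j - real m) * \<theta>) / (2 * real j - real m)))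
        has_real_derivative real (m choose j) / 2 ^ m * cos ((2 * real j - real m) * \<theta>)) (at \<theta>)" for j
  proof (cases "2 * j = m")
    case True
    then have "2 * real j - real m = 0" by auto
    with True show ?thesis by (auto intro!: derivative_eq_intros)
  next
    case False
    then have "2 * real j - real m \<noteq> 0" by linarith
    with False show ?thesis by (auto intro!: derivative_eq_intros)
  qed
  then show ?thesis
    unfolding cos_power_primitive_def [abs_def] cos_power_multiple_angle by (intro DERIV_sum)
qed

lemma cos_power_primitive_0: "cos_power_primitive m 0 = 0"
  unfolding cos_power_primitive_def by (rule sum.neutral) simp

lemma cos_power_primitive_pi: "cos_power_primitive m pi = pi * arcsine_moment m"
proof -
  have "sin ((2 * real j - real m) * pi) = 0" for j
    unfolding sin_zero_iff_int2 by (rule exI[of _ "2 * int j - int m"]) simp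
  then show ?thesis
    by (auto simp: cos_power_primitive_def arcsine_moment_def sum_distrib_left intro!: sum.cong)
qed

text \<open>The substitution \<open>x = cos \<theta>\<close> is carried out through the explicit
  antiderivative \<open>F m\<close>, whose derivative on the open interval is the integrand.\<close>

lemma arcsine_moment:
  shows integrable_arcsine_moment:
      "set_integrable lborel {-1<..<1} (\<lambda>x. x ^ m / (pi * sqrt (1 - x\<^sup>2)))" (is ?int)
    and integral_arcsine_moment:
      "(LINT x:{-1<..<1}|lborel. x ^ m / (pi * sqrt (1 - x\<^sup>2))) = arcsine_moment m" (is ?eq)
proof -
  define f where "f m x = x ^ m / (pi * sqrt (1 - x\<^sup>2))" for m and x :: real
  define F where "F m x = - cos_power_primitive m (arccos x) / pi" for m x
  have pos: "0 < 1 - x\<^sup>2" if "-1 < x" "x < 1" for x :: real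
    using that by (simp add: abs_square_less_1)
  have DF: "DERIV (F m) x :> f m x" if "-1 < x" "x < 1" for m x
  proof -
    have "DERIV (F m) x :> - (cos (arccos x) ^ m * inverse (- sqrt (1 - x\<^sup>2))) / pi"
      unfolding F_def [abs_def] using that
      by (intro DERIV_cdivide DERIV_minus DERIV_chain2[OF DERIV_cos_power_primitive] DERIV_arccos)
    then show ?thesis using that by (simp add: f_def field_simps)
  qed
  have cf: "isCont (f m) x" if "-1 < x" "x < 1" for m x
    unfolding f_def [abs_def] using pos[OF that] by (intro continuous_intros) auto
  have contF: "continuous_on {-1..1} (F m)" for m
  proof -
    have "continuous_on UNIV (cos_power_primitive m)"
      by (meson DERIV_cos_power_primitive DERIV_isCont continuous_at_imp_continuous_on)
    then have "continuous_on {-1..1} (\<lambda>x. cos_power_primitive m (arccos x))"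
      by (rule continuous_on_compose2) (auto intro!: continuous_intros)
    then show ?thesis unfolding F_def [abs_def] by (intro continuous_intros) auto
  qed
  \<comment> \<open>The density blows up at both endpoints, but \<open>F m\<close> is continuous on
    the closed interval, so its one-sided limits exist there.\<close>
  have limA: "((F m \<circ> real_of_ereal) \<longlongrightarrow> F m (-1)) (at_right (ereal (-1)))" for m
    unfolding ereal_tendsto_simps1 using continuous_on_Icc_at_rightD[OF contF] by simp
  have limB: "((F m \<circ> real_of_ereal) \<longlongrightarrow> F m 1) (at_left (ereal 1))" for m
    unfolding ereal_tendsto_simps1 using continuous_on_Icc_at_leftD[OF contF] by simp
  have ein: "einterval (ereal (-1)) (ereal 1) = {-1<..<1}"
    by (auto simp: einterval_def)
  \<comment> \<open>For \<open>m = 0\<close> the integrand is nonnegative, so finite limits of the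
    antiderivative already force integrability. The other moments are then dominated, since
    \<open>\<bar>x\<bar> ^ m \<le> 1\<close>.\<close>
  have "set_integrable lborel (einterval (ereal (-1)) (ereal 1)) (f 0)"
  proof (rule interval_integral_FTC_nonneg(1)[OF _ _ _ _ limA limB])
    show "AE x in lborel. ereal (- 1) < ereal x \<longrightarrow> ereal x < ereal 1 \<longrightarrow> 0 \<le> f 0 x"
      using pos by (intro AE_I2) (auto simp: f_def less_imp_le)
  qed (use DF cf in auto)
  then have int0: "set_integrable lborel {-1<..<1} (f 0)"
    by (simp only: ein)
  have int: "set_integrable lborel {-1<..<1} (f m)" for m
  proof (rule set_integrable_bound[OF int0])
    show "set_borel_measurable lborel {-1<..<1} (f m)"
      unfolding set_borel_measurable_def f_def by measurable
    have "norm (f m x) \<le> norm (f 0 x)" if "x \<in> {-1<..<1}" for x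
    proof -
      have "\<bar>x\<bar> ^ m \<le> 1" using that by (intro power_le_one) auto
      moreover have "0 < pi * sqrt (1 - x\<^sup>2)" using pos that by auto
      ultimately show ?thesis by (simp add: f_def power_abs abs_mult divide_right_mono)
    qed
    then show "AE x\<in>{-1<..<1} in lborel. norm (f m x) \<le> norm (f 0 x)" by auto
  qed
  from int[of m] show ?int unfolding f_def .
  have "(LBINT x=ereal (-1)..ereal 1. f m x) = F m 1 - F m (-1)"
  proof (rule interval_integral_FTC_integrable[OF _ _ _ _ limA limB])
    show "set_integrable lborel (einterval (ereal (- 1)) (ereal 1)) (f m)"
      unfolding ein by (rule int)
  qed (use DF cf in \<open>auto simp: has_real_derivative_iff_has_vector_derivative\<close>)
  also have "\<dots> = arcsine_moment m"
    by (simp add: F_def cos_power_primitive_0 cos_power_primitive_pi)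
  finally show ?eq
    by (simp add: interval_lebesgue_integral_def ein f_def)
qed

text \<open>Fubini for products: the monomial, the density and the indicator of the cube all factor
  over the coordinates.\<close>

lemma equilibrium_monomial:
  fixes e :: "nat \<Rightarrow> nat"
  shows integrable_equilibrium_monomial:
      "set_integrable (lborel_R d) (open_cube d)
         (\<lambda>\<omega>. (\<Prod>i<d. \<omega> i ^ e i) * (1 / (pi ^ d * (\<Prod>i<d. sqrt (1 - (\<omega> i)\<^sup>2)))))" (is ?int)
    and integral_equilibrium_monomial:
      "(LINT \<omega>:open_cube d|lborel_R d.
         (\<Prod>i<d. \<omega> i ^ e i) * (1 / (pi ^ d * (\<Prod>i<d. sqrt (1 - (\<omega> i)\<^sup>2))))) =
       (\<Prod>i<d. arcsine_moment (e i))" (is ?eq)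
proof -
  interpret product_sigma_finite "\<lambda>_::nat. lborel :: real measure"
    by (rule product_sigma_finite.intro) (rule sigma_finite_lborel)
  define g where "g i x = indicat_real {-1<..<1} x *\<^sub>R (x ^ e i / (pi * sqrt (1 - x\<^sup>2)))" for i x
  have g_int: "integrable lborel (g i)" for i
    using integrable_arcsine_moment[of "e i"] unfolding g_def set_integrable_def .
  have g_eq: "integral\<^sup>L lborel (g i) = arcsine_moment (e i)" for i
    using integral_arcsine_moment[of "e i"] unfolding g_def set_lebesgue_integral_def .
  have eq: "indicat_real (open_cube d) \<omega> *\<^sub>R
      ((\<Prod>i<d. \<omega> i ^ e i) * (1 / (pi ^ d * (\<Prod>i<d. sqrt (1 - (\<omega> i)\<^sup>2))))) = (\<Prod>i<d. g i (\<omega> i))"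
    if "\<omega> \<in> space (lborel_R d)" for \<omega>
  proof -
    \<comment> \<open>Extensionality guarantees that a point outside the cube fails at some
      coordinate \<open>i < d\<close>, so that the product of indicators vanishes too.\<close>
    have ext: "\<omega> \<in> extensional {..<d}"
      using that by (auto simp: space_PiM PiE_def)
    have "indicat_real (open_cube d) \<omega> = (\<Prod>i<d. indicat_real {-1<..<1} (\<omega> i))"
    proof (cases "\<omega> \<in> open_cube d")
      case True
      then show ?thesis by (auto simp: open_cube_def PiE_iff)
    next
      case False
      then obtain i where "i < d" "\<omega> i \<notin> {-1<..<1}"
        using ext by (auto simp: open_cube_def PiE_iff)
      then have "\<exists>i\<in>{..<d}. indicat_real {-1<..<1} (\<omega> i) = 0"
        by (intro bexI[of _ i]) auto
      then have "(\<Prod>i<d. indicat_real {-1<..<1} (\<omega> i)) = 0"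
        by (intro prod_zero) auto
      with False show ?thesis by simp
    qed
    then show ?thesis
      by (simp add: g_def prod.distrib prod_dividef)
  qed
  have "integrable (lborel_R d) (\<lambda>\<omega>. \<Prod>i<d. g i (\<omega> i))"
    by (rule product_integrable_prod) (auto simp: g_int)
  then show ?int
    unfolding set_integrable_def by (subst Bochner_Integration.integrable_cong[OF refl eq])
  have "(\<integral>\<omega>. (\<Prod>i<d. g i (\<omega> i)) \<partial>lborel_R d) = (\<Prod>i<d. arcsine_moment (e i))"
    by (subst product_integral_prod) (auto simp: g_int g_eq)
  then show ?eq
    unfolding set_lebesgue_integral_def by (subst Bochner_Integration.integral_cong[OF refl eq])
qed

subsection \<open>Greedy choice of the frequencies\<close>

definition short_combinations :: "nat \<Rightarrow> nat \<Rightarrow> (nat \<Rightarrow> int) \<Rightarrow> int set" where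
  "short_combinations r d h = {\<Sum>i<d. k i * h i | k. (\<Sum>i<d. \<bar>k i\<bar>) \<le> int r}"

text \<open>Moving one nonzero coefficient a unit towards 0 splits off \<open>h i\<close> or
  \<open>- h i\<close> and lowers the l1 norm by one. The zero combination splits off 0.\<close>

lemma short_combinations_Suc_subset:
  "short_combinations (Suc r) d h \<subseteq>
    (\<lambda>(a, b). a + b) ` (({0} \<union> h ` {..<d} \<union> (\<lambda>i. - h i) ` {..<d}) \<times> short_combinations r d h)"
    (is "_ \<subseteq> ?R")
proof
  fix x assume "x \<in> short_combinations (Suc r) d h"
  then obtain k where k: "x = (\<Sum>i<d. k i * h i)" "(\<Sum>i<d. \<bar>k i\<bar>) \<le> int (Suc r)"
    by (auto simp: short_combinations_def)
  show "x \<in> ?R"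
  proof (cases "\<exists>i<d. k i \<noteq> 0")
    case False
    then have "x = 0" using k by simp
    moreover have "0 \<in> short_combinations r d h"
      unfolding short_combinations_def by (auto intro!: exI[of _ "\<lambda>_. 0"])
    ultimately show ?thesis by force
  next
    case True
    then obtain i where i: "i < d" "k i \<noteq> 0" by blast
    define l where "l = k(i := k i - sgn (k i))"
    have upd: "(\<Sum>j<d. f j (l j)) = (\<Sum>j<d. f j (k j)) - f i (k i) + f i (k i - sgn (k i))"
      for f :: "nat \<Rightarrow> int \<Rightarrow> int"
      using i by (simp add: l_def sum.remove[of "{..<d}" i])
    have "(\<Sum>j<d. \<bar>l j\<bar>) \<le> int r"
      using k(2) i(2) upd[of "\<lambda>_ x. \<bar>x\<bar>"] by (auto simp: sgn_if split: if_splits)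
    then have "(\<Sum>j<d. l j * h j) \<in> short_combinations r d h"
      by (auto simp: short_combinations_def)
    moreover have "x = sgn (k i) * h i + (\<Sum>j<d. l j * h j)"
      using k(1) upd[of "\<lambda>j x. x * h j"] by (simp add: algebra_simps)
    moreover have "sgn (k i) * h i \<in> {0} \<union> h ` {..<d} \<union> (\<lambda>i. - h i) ` {..<d}"
      using i by (auto simp: sgn_if)
    ultimately show ?thesis by force
  qed
qed

text \<open>Each unit of the radius offers at most \<open>2 * d + 1\<close> choices: 0 or a signed
  entry of \<open>h\<close>. For fixed \<open>r\<close> this crude count has order
  \<open>d ^ r\<close>, the source of the final exponent.\<close>

lemma short_combinations_bound:
  "finite (short_combinations r d h) \<and> card (short_combinations r d h) \<le> (2 * d + 1) ^ r"
proof (induction r)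
  case 0
  have "short_combinations 0 d h \<subseteq> {0}"
  proof
    fix x assume "x \<in> short_combinations 0 d h"
    then obtain k where k: "x = (\<Sum>i<d. k i * h i)" "(\<Sum>i<d. \<bar>k i\<bar>) \<le> 0"
      by (auto simp: short_combinations_def)
    then have "(\<Sum>i<d. \<bar>k i\<bar>) = 0" by (meson abs_ge_zero antisym sum_nonneg)
    then have "\<forall>i\<in>{..<d}. \<bar>k i\<bar> = 0" by (subst (asm) sum_nonneg_eq_0_iff) auto
    then show "x \<in> {0}" using k by simp
  qed
  then show ?case
    using card_mono[of "{0}" "short_combinations 0 d h"] by (auto intro: finite_subset)
next
  case (Suc r)
  let ?A = "{0} \<union> h ` {..<d} \<union> (\<lambda>i. - h i) ` {..<d}"
  let ?B = "short_combinations r d h"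
  have fin: "finite (?A \<times> ?B)" using Suc by blast
  have "card ?A \<le> card ({0} \<union> h ` {..<d}) + card ((\<lambda>i. - h i) ` {..<d})"
    by (rule card_Un_le)
  also have "\<dots> \<le> card {0::int} + card (h ` {..<d}) + card ((\<lambda>i. - h i) ` {..<d})"
    by (intro add_mono card_Un_le order_refl)
  also have "\<dots> \<le> 1 + d + d"
    using card_image_le[of "{..<d}" h] card_image_le[of "{..<d}" "\<lambda>i. - h i"] by simp
  finally have A: "card ?A \<le> 2 * d + 1" by simp
  have "card (short_combinations (Suc r) d h) \<le> card ((\<lambda>(a, b). a + b) ` (?A \<times> ?B))"
    by (intro card_mono finite_imageI fin short_combinations_Suc_subset)
  also have "\<dots> \<le> card (?A \<times> ?B)" by (intro card_image_le fin)
  also have "\<dots> = card ?A * card ?B" by (rule card_cartesian_product)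
  also have "\<dots> \<le> (2 * d + 1) * (2 * d + 1) ^ r"
    using A Suc by (intro mult_mono) auto
  finally show ?case
    using finite_subset[OF short_combinations_Suc_subset] fin by simp
qed

text \<open>Equivalently, the lattice of all integer vectors \<open>k\<close> with \<open>N\<close>
  dividing the pairing of \<open>k\<close> and \<open>h\<close> has l1 minimum greater than
  \<open>t\<close>.\<close>

definition dissociated_mod :: "nat \<Rightarrow> nat \<Rightarrow> nat \<Rightarrow> (nat \<Rightarrow> int) \<Rightarrow> bool" where
  "dissociated_mod N t d h \<longleftrightarrow>
    (\<forall>k. (\<Sum>i<d. \<bar>k i\<bar>) \<le> int t \<longrightarrow> int N dvd (\<Sum>i<d. k i * h i) \<longrightarrow> (\<forall>i<d. k i = 0))"

lemma card_linear_congruence_le_1: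
  fixes a b :: int
  assumes "coprime a (int N)"
  shows "card {x\<in>{0..<int N}. int N dvd a * x + b} \<le> 1"
proof -
  have "x = y" if xy: "x \<in> {0..<int N}" "y \<in> {0..<int N}"
      "int N dvd a * x + b" "int N dvd a * y + b" for x y
  proof -
    have "int N dvd (a * x + b) - (a * y + b)" using xy by (intro dvd_diff)
    then have "int N dvd a * (x - y)" by (simp add: algebra_simps)
    then have "int N dvd x - y"
      using assms by (simp add: coprime_commute coprime_dvd_mult_right_iff)
    then show "x = y"
      using xy by (metis atLeastLessThan_iff mod_eq_dvd_iff mod_pos_pos_trivial)
  qed
  moreover have "finite {x\<in>{0..<int N}. int N dvd a * x + b}"
    by (rule finite_subset[of _ "{0..<int N}"]) auto
  ultimately show ?thesis
    unfolding One_nat_def by (subst card_le_Suc0_iff_eq) blast+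
qed

text \<open>Union bound: each pair of a new coefficient \<open>a\<close> and an old combination
  \<open>b\<close> forbids at most one residue, and there are fewer pairs than residues.\<close>

lemma dissociated_mod_extend:
  assumes h: "dissociated_mod N t d h" and "t > 0"
    and cop: "\<And>a::int. a \<noteq> 0 \<Longrightarrow> \<bar>a\<bar> \<le> int t \<Longrightarrow> coprime a (int N)"
    and N: "2 * t * (2 * d + 1) ^ (t - 1) < N"
  obtains x where "dissociated_mod N t (Suc d) (h(d := x))"
proof -
  let ?B = "short_combinations (t - 1) d h"
  let ?A = "{- int t..int t} - {0}"
  let ?S = "\<lambda>(a, b). {x\<in>{0..<int N}. int N dvd a * x + b}"
  have B: "finite ?B" "card ?B \<le> (2 * d + 1) ^ (t - 1)"
    using short_combinations_bound by auto
  have A: "card ?A = 2 * t" by (simp add: card_Diff_subset nat_add_distrib nat_mult_distrib)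
  have "card (\<Union>(?S ` (?A \<times> ?B))) \<le> (\<Sum>p\<in>?A \<times> ?B. card (?S p))"
    using B by (intro card_UN_le) auto
  also have "\<dots> \<le> (\<Sum>p\<in>?A \<times> ?B. 1)"
  proof (rule sum_mono)
    fix p assume "p \<in> ?A \<times> ?B"
    then obtain a b where "p = (a, b)" "a \<noteq> 0" "\<bar>a\<bar> \<le> int t" by fastforce
    then show "card (?S p) \<le> 1"
      using card_linear_congruence_le_1[OF cop] by simp
  qed
  also have "\<dots> = card ?A * card ?B" by (simp add: card_cartesian_product)
  also have "\<dots> \<le> 2 * t * (2 * d + 1) ^ (t - 1)" using A B by simp
  also have "\<dots> < card {0..<int N}" using N by simp
  finally have "\<not> {0..<int N} \<subseteq> \<Union>(?S ` (?A \<times> ?B))"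
  proof (rule contrapos_pn)
    assume "{0..<int N} \<subseteq> \<Union>(?S ` (?A \<times> ?B))"
    moreover have "finite (\<Union>(?S ` (?A \<times> ?B)))"
      by (rule finite_subset[of _ "{0..<int N}"]) auto
    ultimately show "\<not> card (\<Union>(?S ` (?A \<times> ?B))) < card {0..<int N}"
      by (meson card_mono not_less)
  qed
  then obtain x where x: "x \<in> {0..<int N}" "x \<notin> \<Union>(?S ` (?A \<times> ?B))" by blast
  have "dissociated_mod N t (Suc d) (h(d := x))"
    unfolding dissociated_mod_def
  proof (rule allI, intro impI)
    fix k :: "nat \<Rightarrow> int"
    assume le: "(\<Sum>i<Suc d. \<bar>k i\<bar>) \<le> int t"
      and "int N dvd (\<Sum>i<Suc d. k i * (h(d := x)) i)"
    then have dvd: "int N dvd k d * x + (\<Sum>i<d. k i * h i)"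
      by (simp add: add.commute)
    have "k d = 0"
    proof (rule ccontr)
      assume nz: "k d \<noteq> 0"
      \<comment> \<open>A nonzero new coefficient uses at least one unit of the budget
        \<open>t\<close>, so the old coefficients have norm at most \<open>t - 1\<close>. This is
        why \<open>?B\<close> has radius \<open>t - 1\<close>.\<close>
      have "(\<Sum>i<d. \<bar>k i\<bar>) \<ge> 0" by (simp add: sum_nonneg)
      moreover have "(\<Sum>i<d. \<bar>k i\<bar>) + \<bar>k d\<bar> \<le> int t" using le by simp
      ultimately have "\<bar>k d\<bar> \<le> int t" "(\<Sum>i<d. \<bar>k i\<bar>) \<le> int t - 1"
        using nz by linarith+
      then have "k d \<in> ?A" "(\<Sum>i<d. \<bar>k i\<bar>) \<le> int (t - 1)"
        using nz \<open>t > 0\<close> by (auto simp: of_nat_diff)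
      moreover from this have "(\<Sum>i<d. k i * h i) \<in> ?B"
        by (auto simp: short_combinations_def)
      ultimately show False using x dvd by blast
    qed
    then show "\<forall>i<Suc d. k i = 0"
      using h le dvd by (auto simp: dissociated_mod_def less_Suc_eq)
  qed
  then show ?thesis by (rule that)
qed

text \<open>The normalisation \<open>h 0 = 1\<close> survives because every extension changes only
  an index \<open>d \<ge> 1\<close>; it later makes the lattice points distinct.\<close>

lemma exists_dissociated_mod:
  assumes "t > 0" and "d > 0"
    and cop: "\<And>a::int. a \<noteq> 0 \<Longrightarrow> \<bar>a\<bar> \<le> int t \<Longrightarrow> coprime a (int N)"
    and N: "2 * t * (2 * d + 1) ^ (t - 1) < N"
  shows "\<exists>h. h 0 = 1 \<and> dissociated_mod N t d h"
  using \<open>d > 0\<close> N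
proof (induction d rule: nat_induct_non_zero)
  case 1
  \<comment> \<open>For \<open>d = 1\<close> it suffices that \<open>t < N\<close>: then no nonzero
    integer of absolute value at most \<open>t\<close> is divisible by \<open>N\<close>.\<close>
  have "t * 1 \<le> 2 * t * (2 * 1 + 1) ^ (t - 1)" by (intro mult_mono) auto
  then have "t < N" using 1 by linarith
  then have "a = 0" if "\<bar>a\<bar> \<le> int t" "int N dvd a" for a
    using that dvd_imp_le_int[of a "int N"] by fastforce
  then have "dissociated_mod N t 1 (\<lambda>_. 1)"
    by (simp add: dissociated_mod_def)
  then show ?case by auto
next
  case (Suc d)
  have "2 * t * (2 * d + 1) ^ (t - 1) \<le> 2 * t * (2 * Suc d + 1) ^ (t - 1)"
    by (intro mult_left_mono power_mono) auto
  then have N': "2 * t * (2 * d + 1) ^ (t - 1) < N" using Suc.prems by linarith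
  with Suc.IH obtain h where h: "h 0 = 1" "dissociated_mod N t d h" by blast
  obtain x where "dissociated_mod N t (Suc d) (h(d := x))"
    using dissociated_mod_extend[OF h(2) \<open>t > 0\<close> cop N'] by blast
  moreover have "(h(d := x)) 0 = 1" using h(1) Suc.hyps by simp
  ultimately show ?case by blast
qed

subsection \<open>The point set\<close>

text \<open>
  The shift by \<open>pi / (2 * N)\<close> keeps the points off the boundary of the cube, and makes the cosine
  injective on the coset, so that no two points collapse.
\<close>

definition cos_lattice_point :: "nat \<Rightarrow> nat \<Rightarrow> (nat \<Rightarrow> int) \<Rightarrow> nat \<Rightarrow> nat \<Rightarrow> real" where
  "cos_lattice_point N d h s =
    (\<lambda>i\<in>{..<d}. cos (2 * pi * real s * real_of_int (h i) / real N + pi / (2 * real N)))"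

text \<open>A coordinate equal to 1 or -1 would make its angle a multiple of \<open>pi\<close>.
  Clearing denominators, the shift turns this into an odd number equal to an even one.\<close>

lemma cos_lattice_point_in_open_cube:
  assumes "N > 0"
  shows "cos_lattice_point N d h s \<in> open_cube d"
proof -
  have "cos (2 * pi * real s * real_of_int a / real N + pi / (2 * real N)) \<in> {-1<..<1}" for a
  proof -
    define \<theta> where "\<theta> = 2 * pi * real s * real_of_int a / real N + pi / (2 * real N)"
    have "sin \<theta> \<noteq> 0"
    proof
      assume "sin \<theta> = 0"
      then obtain j :: int where "\<theta> = of_int j * pi"
        using sin_zero_iff_int2 by blast
      then have "pi * (4 * real s * real_of_int a + 1) = pi * (2 * real N * of_int j)"
        using assms by (simp add: \<theta>_def field_simps)
      then have "4 * real s * real_of_int a + 1 = 2 * real N * of_int j"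
        by simp
      then have "real_of_int (4 * (int s * a) + 1) = real_of_int (2 * (int N * j))"
        by simp
      then have "4 * (int s * a) + 1 = 2 * (int N * j)" by linarith
      then show False by presburger
    qed
    then have "(cos \<theta>)\<^sup>2 < 1"
      using sin_cos_squared_add[of \<theta>] by (smt (verit) zero_less_power2)
    then show ?thesis unfolding \<theta>_def abs_square_less_1 by auto
  qed
  then show ?thesis by (auto simp: open_cube_def cos_lattice_point_def)
qed

text \<open>Coordinate 0 alone separates the points. Equal cosines mean equal or opposite angles
  modulo \<open>2 * pi\<close>: the first case gives \<open>r\<close> congruent to \<open>s\<close>
  modulo \<open>N\<close>, the second is impossible modulo 4 because of the shift.\<close>

lemma inj_on_cos_lattice_point:
  assumes "h 0 = 1" and "d > 0" and "N > 0"
  shows "inj_on (cos_lattice_point N d h) {..<N}"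
proof (rule inj_onI)
  fix r s assume rs: "r \<in> {..<N}" "s \<in> {..<N}"
    and "cos_lattice_point N d h r = cos_lattice_point N d h s"
  then have "cos_lattice_point N d h r 0 = cos_lattice_point N d h s 0" by simp
  then have "cos (2 * pi * real r / real N + pi / (2 * real N)) =
      cos (2 * pi * real s / real N + pi / (2 * real N))"
    using assms by (simp add: cos_lattice_point_def)
  then obtain j :: int where
    "2 * pi * real r / real N + pi / (2 * real N) =
       2 * pi * real s / real N + pi / (2 * real N) + 2 * of_int j * pi \<or>
     2 * pi * real r / real N + pi / (2 * real N) =
       - (2 * pi * real s / real N + pi / (2 * real N)) + 2 * of_int j * pi"
    unfolding cos_eq by (auto elim!: Ints_cases)
  then have "pi * (4 * real r) = pi * (4 * real s + 4 * real N * of_int j) \<or>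
      pi * (4 * real r + 4 * real s + 2) = pi * (4 * real N * of_int j)"
    using \<open>N > 0\<close> by (simp add: field_simps)
  then have "real_of_int (4 * int r) = real_of_int (4 * int s + 4 * (int N * j)) \<or>
      real_of_int (4 * int r + 4 * int s + 2) = real_of_int (4 * (int N * j))"
    unfolding mult_cancel_left by auto
  then have "4 * int r = 4 * int s + 4 * (int N * j) \<or> 4 * int r + 4 * int s + 2 = 4 * (int N * j)"
    unfolding of_int_eq_iff .
  then have "int r = int s + int N * j" by presburger
  then have "int r mod int N = int s mod int N" by simp
  then show "r = s" using rs by simp
qed

text \<open>The product expands into characters indexed by \<open>g\<close>, with frequency vector
  \<open>k g\<close> of l1 norm at most \<open>t\<close>. By dissociation only the zero frequency
  survives summation over \<open>s\<close>, leaving the product of the constant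
  coefficients.\<close>

lemma sum_prod_cos_lattice_point:
  assumes h: "dissociated_mod N t d h" and "N > 0" and e: "(\<Sum>i<d. e i) \<le> t"
  shows "(\<Sum>s<N. \<Prod>i<d. cos_lattice_point N d h s i ^ e i) =
    real N * (\<Prod>i<d. arcsine_moment (e i))"
proof -
  define c where "c m j = real (m choose j) / 2 ^ m" for m j
  define \<theta> where "\<theta> s i = 2 * pi * real s * real_of_int (h i) / real N + pi / (2 * real N)" for s i
  define k where "k g i = 2 * int (g i) - int (e i)" for g i
  let ?P = "\<Pi>\<^sub>E i\<in>{..<d}. {..e i}"
  have sum_cis: "(\<Sum>s<N. cis (\<Sum>i<d. real_of_int (k g i) * \<theta> s i)) =
      (if \<forall>i<d. k g i = 0 then of_nat N else 0)" if g: "g \<in> ?P" for g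
  proof -
    let ?K = "\<Sum>i<d. k g i * h i"
    \<comment> \<open>The shift contributes only this phase, which does not depend on
      \<open>s\<close> and equals 1 at frequency zero.\<close>
    let ?u = "cis (\<Sum>i<d. real_of_int (k g i) * (pi / (2 * real N)))"
    have "(\<Sum>i<d. real_of_int (k g i) * \<theta> s i) =
        (\<Sum>i<d. real_of_int (k g i) * (pi / (2 * real N))) + 2 * pi * real s * of_int ?K / real N" for s
      unfolding \<theta>_def of_int_sum sum_distrib_left sum_divide_distrib sum.distrib[symmetric]
      by (rule sum.cong) (auto simp: algebra_simps)
    then have "(\<Sum>s<N. cis (\<Sum>i<d. real_of_int (k g i) * \<theta> s i)) =
        ?u * (\<Sum>s<N. cis (2 * pi * real s * of_int ?K / real N))"
      by (simp only: cis_mult[symmetric] sum_distrib_left)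
    also have "\<dots> = ?u * (if int N dvd ?K then of_nat N else 0)"
      by (subst sum_cis_roots_of_unity[OF \<open>N > 0\<close>]) (rule refl)
    also have "\<dots> = (if \<forall>i<d. k g i = 0 then of_nat N else 0)"
    proof (cases "\<forall>i<d. k g i = 0")
      case True
      then show ?thesis by simp
    next
      case False
      have "(\<Sum>i<d. \<bar>k g i\<bar>) \<le> (\<Sum>i<d. int (e i))"
      proof (rule sum_mono)
        fix i assume "i \<in> {..<d}"
        then have "g i \<le> e i" using g by auto
        then show "\<bar>k g i\<bar> \<le> int (e i)" unfolding k_def by linarith
      qed
      also have "\<dots> = int (\<Sum>i<d. e i)" by simp
      also have "\<dots> \<le> int t" using e by (simp only: of_nat_le_iff)
      finally have "\<not> int N dvd ?K"
        using h False unfolding dissociated_mod_def by blast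
      with False show ?thesis by auto
    qed
    finally show ?thesis .
  qed
  have "complex_of_real (\<Sum>s<N. \<Prod>i<d. cos_lattice_point N d h s i ^ e i) =
      (\<Sum>s<N. \<Prod>i<d. complex_of_real (cos (\<theta> s i)) ^ e i)"
    by (simp add: cos_lattice_point_def \<theta>_def)
  also have "\<dots> = (\<Sum>s<N. \<Prod>i<d. \<Sum>j\<le>e i. of_real (c (e i) j) * cis ((2 * real j - real (e i)) * \<theta> s i))"
    unfolding cos_power_cis c_def ..
  also have "\<dots> = (\<Sum>s<N. \<Sum>g\<in>?P. \<Prod>i<d. of_real (c (e i) (g i)) * cis ((2 * real (g i) - real (e i)) * \<theta> s i))"
    by (subst prod_sum_PiE) auto
  also have "\<dots> = (\<Sum>s<N. \<Sum>g\<in>?P. (\<Prod>i<d. of_real (c (e i) (g i))) * cis (\<Sum>i<d. real_of_int (k g i) * \<theta> s i))"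
    by (simp add: prod.distrib prod_cis k_def)
  also have "\<dots> = (\<Sum>g\<in>?P. (\<Prod>i<d. of_real (c (e i) (g i))) * (\<Sum>s<N. cis (\<Sum>i<d. real_of_int (k g i) * \<theta> s i)))"
    unfolding sum_distrib_left by (rule sum.swap)
  also have "\<dots> = (\<Sum>g\<in>?P. of_nat N * (\<Prod>i<d. if 2 * g i = e i then of_real (c (e i) (g i)) else 0))"
  proof (rule sum.cong[OF refl])
    fix g assume g: "g \<in> ?P"
    show "(\<Prod>i<d. of_real (c (e i) (g i))) * (\<Sum>s<N. cis (\<Sum>i<d. real_of_int (k g i) * \<theta> s i)) =
      of_nat N * (\<Prod>i<d. if 2 * g i = e i then complex_of_real (c (e i) (g i)) else 0)"
    proof (cases "\<forall>i<d. k g i = 0")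
      case True
      then have "2 * g i = e i" if "i < d" for i
        using that by (auto simp: k_def)
      then show ?thesis using True by (simp add: sum_cis[OF g])
    next
      case False
      then obtain i where "i < d" "2 * g i \<noteq> e i" by (auto simp: k_def)
      then have "(\<Prod>i<d. if 2 * g i = e i then complex_of_real (c (e i) (g i)) else 0) = 0"
        by (intro prod_zero) auto
      then show ?thesis
        unfolding sum_cis[OF g] if_not_P[OF False] by (simp only: mult_zero_right)
    qed
  qed
  \<comment> \<open>Distributivity in the reverse direction: the restriction to zero frequency holds
    coordinatewise, so the sum over \<open>g\<close> factors again.\<close>
  also have "\<dots> = of_nat N * (\<Prod>i<d. \<Sum>j\<le>e i. if 2 * j = e i then complex_of_real (c (e i) j) else 0)"
    by (subst prod_sum_PiE) (auto simp: sum_distrib_left)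
  also have "\<dots> = complex_of_real (real N * (\<Prod>i<d. arcsine_moment (e i)))"
    unfolding arcsine_moment_def c_def
    by (simp add: if_distrib[of complex_of_real] cong: if_cong)
  finally show ?thesis unfolding of_real_eq_iff .
qed

section \<open>From monomials to polynomials\<close>

lemma mpoly_eval_full:
  assumes "f \<in> mpolys_upto d t"
  shows "mpoly_eval f x = (\<Sum>m\<in>Poly_Mapping.keys f. Poly_Mapping.lookup f m *
    (\<Prod>i<d. x i ^ Poly_Mapping.lookup m i))"
  unfolding mpoly_eval_def
proof (rule sum.cong[OF refl])
  fix m assume "m \<in> Poly_Mapping.keys f"
  then have "Poly_Mapping.keys m \<subseteq> {..<d}" using assms by (auto simp: mpolys_upto_def)
  then have "(\<Prod>i\<in>Poly_Mapping.keys m. x i ^ Poly_Mapping.lookup m i) =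
      (\<Prod>i<d. x i ^ Poly_Mapping.lookup m i)"
    by (intro prod.mono_neutral_left) (auto simp: in_keys_iff)
  then show "Poly_Mapping.lookup f m * (\<Prod>i\<in>Poly_Mapping.keys m. x i ^ Poly_Mapping.lookup m i) =
      Poly_Mapping.lookup f m * (\<Prod>i<d. x i ^ Poly_Mapping.lookup m i)" by simp
qed

lemma mpolys_upto_degree_le:
  assumes "f \<in> mpolys_upto d t" and "m \<in> Poly_Mapping.keys f"
  shows "(\<Sum>i<d. Poly_Mapping.lookup m i) \<le> t"
proof -
  have "Poly_Mapping.keys m \<subseteq> {..<d}" "monom_degree m \<le> t"
    using assms by (auto simp: mpolys_upto_def)
  moreover from this(1) have "monom_degree m = (\<Sum>i<d. Poly_Mapping.lookup m i)"
    unfolding monom_degree_def by (intro sum.mono_neutral_left) (auto simp: in_keys_iff)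
  ultimately show ?thesis by simp
qed

text \<open>Linearity of the integral, justified by the integrability of each monomial against the
  density.\<close>

lemma equilibrium_integral_mpoly:
  assumes "f \<in> mpolys_upto d t"
  shows "(LINT \<omega>:open_cube d|lborel_R d.
      mpoly_eval f \<omega> * (1 / (pi ^ d * (\<Prod>i<d. sqrt (1 - (\<omega> i)\<^sup>2))))) =
    (\<Sum>m\<in>Poly_Mapping.keys f. Poly_Mapping.lookup f m * (\<Prod>i<d. arcsine_moment (Poly_Mapping.lookup m i)))"
proof -
  define w where "w \<omega> = 1 / (pi ^ d * (\<Prod>i<d. sqrt (1 - (\<omega> i)\<^sup>2)))" for \<omega> :: "nat \<Rightarrow> real"
  have "(LINT \<omega>:open_cube d|lborel_R d. mpoly_eval f \<omega> * w \<omega>) =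
      (LINT \<omega>|lborel_R d. (\<Sum>m\<in>Poly_Mapping.keys f. Poly_Mapping.lookup f m *
        (indicat_real (open_cube d) \<omega> *\<^sub>R ((\<Prod>i<d. \<omega> i ^ Poly_Mapping.lookup m i) * w \<omega>))))"
    unfolding set_lebesgue_integral_def mpoly_eval_full[OF assms]
    by (simp add: sum_distrib_left sum_distrib_right mult_ac)
  also have "\<dots> = (\<Sum>m\<in>Poly_Mapping.keys f. Poly_Mapping.lookup f m *
      (LINT \<omega>:open_cube d|lborel_R d. (\<Prod>i<d. \<omega> i ^ Poly_Mapping.lookup m i) * w \<omega>))"
    using integrable_equilibrium_monomial[of d]
    unfolding w_def [symmetric] set_integrable_def set_lebesgue_integral_def
    by (subst Bochner_Integration.integral_sum)
      (auto intro!: integrable_mult_right simp del: real_scaleR_def mult_scaleR_right)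
  also have "\<dots> = (\<Sum>m\<in>Poly_Mapping.keys f. Poly_Mapping.lookup f m * (\<Prod>i<d. arcsine_moment (Poly_Mapping.lookup m i)))"
    unfolding w_def by (simp only: integral_equilibrium_monomial)
  finally show ?thesis unfolding w_def .
qed

text \<open>Injectivity gives \<open>card X = N\<close> and lets the average over the set
  \<open>X\<close> be computed as an average over the indices \<open>s\<close>. The monomial
  identity then applies term by term.\<close>

lemma cos_lattice_design:
  assumes "dissociated_mod N t d h" and "h 0 = 1" and "d > 0" and "N > 0"
    and f: "f \<in> mpolys_upto d t"
  defines "X \<equiv> cos_lattice_point N d h ` {..<N}"
  shows "1 / real (card X) * (\<Sum>x\<in>X. mpoly_eval f x) =
    (LINT \<omega>:open_cube d|lborel_R d.
      mpoly_eval f \<omega> * (1 / (pi ^ d * (\<Prod>i<d. sqrt (1 - (\<omega> i)\<^sup>2)))))"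
proof -
  have inj: "inj_on (cos_lattice_point N d h) {..<N}"
    using assms by (intro inj_on_cos_lattice_point)
  then have card: "card X = N" by (simp add: X_def card_image)
  have "(\<Sum>x\<in>X. mpoly_eval f x) = (\<Sum>s<N. \<Sum>m\<in>Poly_Mapping.keys f. Poly_Mapping.lookup f m *
      (\<Prod>i<d. cos_lattice_point N d h s i ^ Poly_Mapping.lookup m i))"
    unfolding X_def sum.reindex[OF inj] mpoly_eval_full[OF f] by simp
  also have "\<dots> = (\<Sum>m\<in>Poly_Mapping.keys f. Poly_Mapping.lookup f m *
      (\<Sum>s<N. \<Prod>i<d. cos_lattice_point N d h s i ^ Poly_Mapping.lookup m i))"
    unfolding sum_distrib_left by (rule sum.swap)
  also have "\<dots> = (\<Sum>m\<in>Poly_Mapping.keys f. Poly_Mapping.lookup f m *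
      (real N * (\<Prod>i<d. arcsine_moment (Poly_Mapping.lookup m i))))"
    by (intro sum.cong refl arg_cong2[where f = "(*)"] sum_prod_cos_lattice_point[OF assms(1) \<open>N > 0\<close>]
        mpolys_upto_degree_le[OF f])
  finally show ?thesis
    unfolding equilibrium_integral_mpoly[OF f] card
    using \<open>N > 0\<close> by (simp add: sum_distrib_left mult_ac)
qed

section \<open>Choice of the modulus and conclusion\<close>

text \<open>Such an \<open>a\<close> divides \<open>fact t\<close>, hence the predecessor of the
  modulus, and consecutive integers are coprime.\<close>

lemma coprime_fact_mult_add_1:
  fixes a :: int
  assumes "a \<noteq> 0" and "\<bar>a\<bar> \<le> int t"
  shows "coprime a (int (fact t * M + 1))"
proof -
  have "nat \<bar>a\<bar> dvd fact t" using assms by (intro dvd_fact) auto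
  then have "int (nat \<bar>a\<bar>) dvd int (fact t)" by (rule of_nat_dvd_iff[THEN iffD2])
  then have "a dvd int (fact t * M)" by simp
  then have "coprime a (1 + int (fact t * M))"
    by (metis coprime_1_right coprime_iff_gcd_eq_1 dvdE gcd_add_mult mult.commute add.commute)
  then show ?thesis by (simp add: add.commute)
qed

theorem theorem4p8:
  fixes n t :: nat
  assumes "primepow n" and "t = 2 * n - 1"
  shows "\<exists>C::real. C > 0 \<and>
    (\<forall>d\<ge>t. \<exists>X. finite X \<and> X \<subseteq> open_cube d \<and>
       real (card X) \<le> C * real d ^ (t - 1) \<and>
       (\<forall>f\<in>mpolys_upto d t.
          1 / real (card X) * (\<Sum>x\<in>X. mpoly_eval f x) =
          (LINT \<omega>:open_cube d|lborel_R d.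
             mpoly_eval f \<omega> * (1 / (pi ^ d * (\<Prod>i<d. sqrt (1 - (\<omega> i)\<^sup>2)))))))"
proof -
  have "n > 0" using assms(1) primepow_gt_0_nat by blast
  then have t: "t > 0" using assms(2) by simp
  \<comment> \<open>The factor \<open>3 ^ (t - 1)\<close> comes from
    \<open>2 * d + 1 \<le> 3 * d\<close>, and the final 1 absorbs the \<open>+ 1\<close> in
    \<open>N\<close>.\<close>
  define C where "C = fact t * (2 * t * 3 ^ (t - 1)) + (1::nat)"
  show ?thesis
  proof (intro exI[of _ "real C"] conjI allI impI)
    show "0 < real C" unfolding C_def of_nat_0_less_iff by simp
    fix d assume "t \<le> d"
    then have d: "d > 0" using t by simp
    \<comment> \<open>\<open>M\<close> bounds the number of forbidden residues at a greedy step.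
      Taking \<open>N\<close> as \<open>fact t * M + 1\<close> makes it exceed \<open>M\<close>,
      keeps it of order \<open>d ^ (t - 1)\<close>, and makes it coprime to all small
      coefficients.\<close>
    define M where "M = 2 * t * (2 * d + 1) ^ (t - 1)"
    define N where "N = fact t * M + 1"
    have "M \<le> fact t * M" by simp
    then have MN: "2 * t * (2 * d + 1) ^ (t - 1) < N" unfolding N_def M_def[symmetric] by linarith
    obtain h where h: "h 0 = 1" "dissociated_mod N t d h"
      using exists_dissociated_mod[OF t d coprime_fact_mult_add_1 MN[unfolded N_def]]
      unfolding N_def by blast
    have N: "N > 0" by (simp add: N_def)
    define X where "X = cos_lattice_point N d h ` {..<N}"
    have "(2 * d + 1) ^ (t - 1) \<le> (3 * d) ^ (t - 1)" using d by (intro power_mono) auto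
    then have "M \<le> 2 * t * 3 ^ (t - 1) * d ^ (t - 1)"
      unfolding M_def by (simp add: power_mult_distrib)
    then have "N \<le> fact t * (2 * t * 3 ^ (t - 1) * d ^ (t - 1)) + d ^ (t - 1)"
      unfolding N_def using d by (intro add_mono mult_left_mono) auto
    also have "\<dots> = C * d ^ (t - 1)" by (simp add: C_def algebra_simps)
    finally have NC: "N \<le> C * d ^ (t - 1)" .
    have "card X \<le> N" unfolding X_def using card_image_le[of "{..<N}"] by simp
    with NC have "real (card X) \<le> real (C * d ^ (t - 1))" by linarith
    then have "real (card X) \<le> real C * real d ^ (t - 1)" by simp
    moreover have "X \<subseteq> open_cube d"
      unfolding X_def using cos_lattice_point_in_open_cube[OF N] by auto
    moreover have "finite X" by (simp add: X_def)
    ultimately show "\<exists>X. finite X \<and> X \<subseteq> open_cube d \<and>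
       real (card X) \<le> real C * real d ^ (t - 1) \<and>
       (\<forall>f\<in>mpolys_upto d t.
          1 / real (card X) * (\<Sum>x\<in>X. mpoly_eval f x) =
          (LINT \<omega>:open_cube d|lborel_R d.
             mpoly_eval f \<omega> * (1 / (pi ^ d * (\<Prod>i<d. sqrt (1 - (\<omega> i)\<^sup>2))))))"
      using cos_lattice_design[OF h(2,1) d N] unfolding X_def by blast
  qed
qed

end
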